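(* Let $G$ be a just-infinite group with finite generating set $X\subset G$. Then there exists a generating set $\tilde{X}$ of $G$, obtained from $X$ by adding at most one element of $G$ (that is, $\tilde X = X$ or $\tilde X = X\cup\{c\}$ for some $c\in G$), such that $pw(G,\tilde{X})<\infty$.
   Context: A group $G$ is called just-infinite if for every non-trivial normal subgroup $N$ of $G$ the quotient $G/N$ is finite. Let $G$ be a group with generating set $X$, and write $X^{\pm 1} = X \cup X^{-1}$. Let $F_X$ be the free group on $X$ and $\pi: F_X \to G$ the natural map. An element of $F_X$ is called a palindrome if it can be written as $y_1 y_2 \cdots y_k$ with each $y_j \in X^{\pm 1}$ (regarded as letters of $F_X$) and $y_j = y_{k-j+1}$ for all $1 \le j \le k$. An element of $G$ is called a palindrome (with respect to $X$) if at least one of its preimages under $\pi$ is a palindrome in $F_X$. Let $P_{G,X}$ be the set of all palindromes of $G$ with respect to $X$. The palindromic width of $G$ with respect to $X$ is $$pw(G,X)=\sup_{g \in G} \min\Big\{ k \;\Big|\; g = \prod_{i=1}^k p_i,\ p_i \in P_{G,X}\Big\},$$ which may be infinite. *)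

theory Defs
  imports "HOL-Algebra.Generated_Groups" "HOL-Library.Extended_Nat"
begin

definition just_infinite :: "('a, 'b) monoid_scheme \<Rightarrow> bool" where
  "just_infinite G \<longleftrightarrow>
     group G \<and> (\<forall>N. N \<lhd> G \<and> N \<noteq> {\<one>\<^bsub>G\<^esub>} \<longrightarrow> finite (carrier (G Mod N)))"

definition list_prod :: "('a, 'b) monoid_scheme \<Rightarrow> 'a list \<Rightarrow> 'a" where
  "list_prod G xs = foldr (\<otimes>\<^bsub>G\<^esub>) xs \<one>\<^bsub>G\<^esub>"


subsection \<open>The free group on a set\<close>

text \<open>A letter \<open>(x, True)\<close> stands for \<open>x\<close> and \<open>(x, False)\<close> for its formal inverse. The elements
  of the free group are the words over \<open>S\<close> modulo insertion and deletion of adjacent inverse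
  letters.\<close>

type_synonym 'a fword = "('a \<times> bool) list"

definition fwords :: "'a set \<Rightarrow> 'a fword set" where
  "fwords S = lists (S \<times> UNIV)"

inductive_set free_rel :: "'a set \<Rightarrow> ('a fword \<times> 'a fword) set" for S :: "'a set" where
  refl: "w \<in> fwords S \<Longrightarrow> (w, w) \<in> free_rel S"
| sym: "(u, v) \<in> free_rel S \<Longrightarrow> (v, u) \<in> free_rel S"
| trans: "(u, v) \<in> free_rel S \<Longrightarrow> (v, w) \<in> free_rel S \<Longrightarrow> (u, w) \<in> free_rel S"
| cancel: "u \<in> fwords S \<Longrightarrow> v \<in> fwords S \<Longrightarrow> x \<in> S \<Longrightarrow>
    (u @ [(x, b), (x, \<not> b)] @ v, u @ v) \<in> free_rel S"

definition free_group :: "'a set \<Rightarrow> 'a fword set monoid" where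
  "free_group S =
    \<lparr> carrier = fwords S // free_rel S,
      mult = (\<lambda>A B. \<Union>u\<in>A. \<Union>v\<in>B. free_rel S `` {u @ v}),
      one = free_rel S `` {[]} \<rparr>"

definition free_gen :: "'a set \<Rightarrow> 'a \<Rightarrow> 'a fword set" where
  "free_gen S x = free_rel S `` {[(x, True)]}"

definition word_eval :: "('a, 'b) monoid_scheme \<Rightarrow> 'a fword \<Rightarrow> 'a" where
  "word_eval G w = list_prod G (map (\<lambda>(x, b). if b then x else inv\<^bsub>G\<^esub> x) w)"

text \<open>All words in a class \<open>A\<close> have the same value in \<open>G\<close>; see \<open>natural_map_class\<close> below.\<close>

definition natural_map :: "('a, 'b) monoid_scheme \<Rightarrow> 'a fword set \<Rightarrow> 'a" where
  "natural_map G A = the_elem (word_eval G ` A)"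


subsection \<open>Palindromes and palindromic width\<close>

definition free_letters :: "'a set \<Rightarrow> 'a fword set set" where
  "free_letters S = free_gen S ` S \<union> (\<lambda>x. inv\<^bsub>free_group S\<^esub> (free_gen S x)) ` S"

definition free_palindromes :: "'a set \<Rightarrow> 'a fword set set" where
  "free_palindromes S =
    {list_prod (free_group S) ys | ys. set ys \<subseteq> free_letters S \<and> rev ys = ys}"

definition palindromes :: "('a, 'b) monoid_scheme \<Rightarrow> 'a set \<Rightarrow> 'a set" where
  "palindromes G S =
    {g \<in> carrier G. \<exists>p \<in> carrier (free_group S). natural_map G p = g \<and> p \<in> free_palindromes S}"

text \<open>The infimum of a nonempty set of extended naturals is its minimum; an element that is not a
  product of palindromes contributes \<open>\<infinity>\<close>.\<close>

definition palindromic_width :: "('a, 'b) monoid_scheme \<Rightarrow> 'a set \<Rightarrow> enat" where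
  "palindromic_width G S =
    (SUP g \<in> carrier G.
      INF k \<in> {k. \<exists>ps. length ps = k \<and> set ps \<subseteq> palindromes G S \<and> g = list_prod G ps}. enat k)"


subsection \<open>Basic properties of the free group and of the natural map\<close>

lemma fwords_Nil [simp]: "[] \<in> fwords S"
  and fwords_append [simp]: "u @ v \<in> fwords S \<longleftrightarrow> u \<in> fwords S \<and> v \<in> fwords S"
  and fwords_Cons [simp]: "(x, b) # v \<in> fwords S \<longleftrightarrow> x \<in> S \<and> v \<in> fwords S"
  by (auto simp: fwords_def)

lemma free_rel_fwords: "(u, v) \<in> free_rel S \<Longrightarrow> u \<in> fwords S \<and> v \<in> fwords S"
  by (induction rule: free_rel.induct) auto

lemma equiv_free_rel: "equiv (fwords S) (free_rel S)"
proof (rule equivI)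
  show "free_rel S \<subseteq> fwords S \<times> fwords S"
    using free_rel_fwords by fastforce
  show "refl_on (fwords S) (free_rel S)"
    by (simp add: refl_on_def free_rel.refl)
  show "sym (free_rel S)"
    by (rule symI) (rule free_rel.sym)
  show "trans (free_rel S)"
    by (rule transI) (rule free_rel.trans)
qed

lemma free_rel_context:
  assumes "(u, v) \<in> free_rel S" "p \<in> fwords S" "q \<in> fwords S"
  shows "(p @ u @ q, p @ v @ q) \<in> free_rel S"
  using assms(1)
proof (induction rule: free_rel.induct)
  case (cancel u v x b)
  then show ?case
    using free_rel.cancel[of "p @ u" S "v @ q" x b] assms(2,3) by simp
next
  case (trans u v w)
  show ?case by (rule free_rel.trans[OF trans.IH])
qed (use assms(2,3) in \<open>simp_all add: free_rel.refl free_rel.sym\<close>)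

lemma free_rel_append:
  assumes "(u, u') \<in> free_rel S" "(v, v') \<in> free_rel S"
  shows "(u @ v, u' @ v') \<in> free_rel S"
proof (rule free_rel.trans)
  show "(u @ v, u' @ v) \<in> free_rel S"
    using free_rel_context[OF assms(1), of "[]" v] free_rel_fwords[OF assms(2)] by simp
  show "(u' @ v, u' @ v') \<in> free_rel S"
    using free_rel_context[OF assms(2), of u' "[]"] free_rel_fwords[OF assms(1)] by simp
qed

lemma carrier_free_group: "carrier (free_group S) = fwords S // free_rel S"
  by (simp add: free_group_def)

lemma one_free_group: "\<one>\<^bsub>free_group S\<^esub> = free_rel S `` {[]}"
  by (simp add: free_group_def)

lemma class_in_free_group: "w \<in> fwords S \<Longrightarrow> free_rel S `` {w} \<in> carrier (free_group S)"
  by (simp add: carrier_free_group quotientI)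

lemma mult_free_group:
  assumes "u \<in> fwords S" "v \<in> fwords S"
  shows "free_rel S `` {u} \<otimes>\<^bsub>free_group S\<^esub> free_rel S `` {v} = free_rel S `` {u @ v}"
proof -
  have "free_rel S `` {u' @ v'} = free_rel S `` {u @ v}"
    if "u' \<in> free_rel S `` {u}" "v' \<in> free_rel S `` {v}" for u' v'
    using equiv_class_eq[OF equiv_free_rel free_rel_append] that by blast
  moreover have "u \<in> free_rel S `` {u}" "v \<in> free_rel S `` {v}"
    using assms by (simp_all add: free_rel.refl)
  ultimately have "(\<Union>u'\<in>free_rel S `` {u}. \<Union>v'\<in>free_rel S `` {v}. free_rel S `` {u' @ v'})
      = free_rel S `` {u @ v}"
    by blast
  then show ?thesis
    by (simp add: free_group_def)
qed

definition inv_word :: "'a fword \<Rightarrow> 'a fword" where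
  "inv_word w = rev (map (\<lambda>(x, b). (x, \<not> b)) w)"

lemma inv_word_fwords [simp]: "w \<in> fwords S \<Longrightarrow> inv_word w \<in> fwords S"
  by (auto simp: inv_word_def fwords_def)

lemma inv_word_cancel: "w \<in> fwords S \<Longrightarrow> (inv_word w @ w, []) \<in> free_rel S"
proof (induction w)
  case Nil
  then show ?case by (simp add: inv_word_def free_rel.refl)
next
  case (Cons a w)
  obtain x b where a: "a = (x, b)" by (cases a)
  have w: "x \<in> S" "w \<in> fwords S" using Cons.prems a by auto
  have "(inv_word w @ [(x, \<not> b), (x, \<not> \<not> b)] @ w, inv_word w @ w) \<in> free_rel S"
    using w by (intro free_rel.cancel) auto
  from free_rel.trans[OF this Cons.IH[OF w(2)]] show ?case
    by (simp add: inv_word_def a)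
qed

lemma group_free_group: "group (free_group S)"
proof (rule groupI)
  show "\<one>\<^bsub>free_group S\<^esub> \<in> carrier (free_group S)"
    by (simp add: one_free_group class_in_free_group)
next
  fix A B assume "A \<in> carrier (free_group S)" "B \<in> carrier (free_group S)"
  then show "A \<otimes>\<^bsub>free_group S\<^esub> B \<in> carrier (free_group S)"
    by (auto simp: carrier_free_group mult_free_group intro!: quotientI elim!: quotientE)
next
  fix A B C
  assume "A \<in> carrier (free_group S)" "B \<in> carrier (free_group S)" "C \<in> carrier (free_group S)"
  then show "A \<otimes>\<^bsub>free_group S\<^esub> B \<otimes>\<^bsub>free_group S\<^esub> C
      = A \<otimes>\<^bsub>free_group S\<^esub> (B \<otimes>\<^bsub>free_group S\<^esub> C)"
    by (auto simp: carrier_free_group mult_free_group elim!: quotientE)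
next
  fix A assume "A \<in> carrier (free_group S)"
  then show "\<one>\<^bsub>free_group S\<^esub> \<otimes>\<^bsub>free_group S\<^esub> A = A"
    by (auto simp: carrier_free_group one_free_group mult_free_group elim!: quotientE)
next
  fix A assume "A \<in> carrier (free_group S)"
  then obtain w where w: "w \<in> fwords S" "A = free_rel S `` {w}"
    by (auto simp: carrier_free_group elim!: quotientE)
  have "free_rel S `` {inv_word w} \<otimes>\<^bsub>free_group S\<^esub> A = \<one>\<^bsub>free_group S\<^esub>"
    using w equiv_class_eq[OF equiv_free_rel inv_word_cancel[OF w(1)]]
    by (simp add: mult_free_group one_free_group)
  then show "\<exists>B\<in>carrier (free_group S). B \<otimes>\<^bsub>free_group S\<^esub> A = \<one>\<^bsub>free_group S\<^esub>"
    using w(1) by (meson class_in_free_group inv_word_fwords)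
qed

context group
begin

lemma list_prod_closed: "set xs \<subseteq> carrier G \<Longrightarrow> list_prod G xs \<in> carrier G"
  by (induction xs) (auto simp: list_prod_def)

lemma list_prod_append:
  "set xs \<subseteq> carrier G \<Longrightarrow> set ys \<subseteq> carrier G \<Longrightarrow>
    list_prod G (xs @ ys) = list_prod G xs \<otimes> list_prod G ys"
proof (induction xs)
  case Nil
  then show ?case using list_prod_closed[of ys] by (simp add: list_prod_def)
next
  case (Cons a xs)
  then show ?case
    using list_prod_closed[of xs] list_prod_closed[of ys] by (simp add: list_prod_def m_assoc)
qed

lemma word_letters_closed:
  "S \<subseteq> carrier G \<Longrightarrow> w \<in> fwords S \<Longrightarrow>
    set (map (\<lambda>(x, b). if b then x else inv x) w) \<subseteq> carrier G"
  by (auto simp: fwords_def split: if_splits)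

lemma word_eval_closed: "S \<subseteq> carrier G \<Longrightarrow> w \<in> fwords S \<Longrightarrow> word_eval G w \<in> carrier G"
  unfolding word_eval_def by (intro list_prod_closed word_letters_closed)

lemma word_eval_append:
  "S \<subseteq> carrier G \<Longrightarrow> u \<in> fwords S \<Longrightarrow> v \<in> fwords S \<Longrightarrow>
    word_eval G (u @ v) = word_eval G u \<otimes> word_eval G v"
  unfolding word_eval_def map_append by (intro list_prod_append word_letters_closed)

lemma word_eval_free_rel:
  assumes "S \<subseteq> carrier G" "(u, v) \<in> free_rel S"
  shows "word_eval G u = word_eval G v"
  using assms(2)
proof (induction rule: free_rel.induct)
  case (cancel u v x b)
  have x: "x \<in> carrier G" using cancel assms(1) by auto
  have "word_eval G [(x, b), (x, \<not> b)] = \<one>"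
    using x by (auto simp: word_eval_def list_prod_def)
  moreover have "[(x, b), (x, \<not> b)] \<in> fwords S" using cancel by simp
  ultimately show ?case
    using cancel assms(1) word_eval_closed[OF assms(1)]
    by (simp only: word_eval_append[OF assms(1)] fwords_append) simp
qed auto

lemma natural_map_class:
  assumes "S \<subseteq> carrier G" "w \<in> fwords S"
  shows "natural_map G (free_rel S `` {w}) = word_eval G w"
proof -
  have "word_eval G ` (free_rel S `` {w}) = {word_eval G w}"
  proof (intro subset_antisym subsetI)
    fix y assume "y \<in> word_eval G ` (free_rel S `` {w})"
    then obtain v where "(w, v) \<in> free_rel S" "y = word_eval G v" by blast
    then show "y \<in> {word_eval G w}"
      using word_eval_free_rel[OF assms(1)] by simp
  next
    fix y assume "y \<in> {word_eval G w}"
    then show "y \<in> word_eval G ` (free_rel S `` {w})"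
      using free_rel.refl[OF assms(2)] by blast
  qed
  then show ?thesis by (simp add: natural_map_def)
qed

lemma natural_map_hom:
  assumes "S \<subseteq> carrier G"
  shows "natural_map G \<in> hom (free_group S) G"
  by (rule homI)
    (auto simp: carrier_free_group mult_free_group natural_map_class[OF assms]
      word_eval_append[OF assms] intro!: word_eval_closed[OF assms] elim!: quotientE)

lemma natural_map_free_gen:
  "S \<subseteq> carrier G \<Longrightarrow> x \<in> S \<Longrightarrow> natural_map G (free_gen S x) = x"
  by (auto simp: free_gen_def natural_map_class word_eval_def list_prod_def)

end

end

theory Submission
  imports Defs
begin

text \<open>If \<open>w\<close> is a word with value \<open>1\<close>, then the value of \<open>rev w\<close> equals that of the palindrome
  \<open>rev w @ w\<close>. The values of the reversed relators form a normal subgroup \<open>N\<close>, so if \<open>N\<close> is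
  non-trivial it has finite index and consists of palindromes, and the palindromic width is finite.
  Suppose that \<open>N\<close> is trivial even after adding an arbitrary generator \<open>c\<close>. If \<open>c\<close> is the value
  of \<open>w\<close>, reversing the relator \<open>c\<inverse>w\<close> shows that \<open>rev w\<close> has value \<open>c\<close>, too. Hence
  reversing a product does not change it and \<open>G\<close> is abelian. There the squares are palindromes, since
  \<open>w @ rev w\<close> has value \<open>w\<^sup>2\<close>, and every element is a square times a word without repeated
  letters.\<close>

section \<open>Classes of letters and words in the free group\<close>

lemma fwords_rev [simp]: "rev w \<in> fwords S \<longleftrightarrow> w \<in> fwords S"
  by (auto simp: fwords_def)

lemma rev_inv_word: "rev (inv_word w) = inv_word (rev w)"
  by (simp add: inv_word_def rev_map)

lemma inv_free_gen:
  assumes "x \<in> S"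
  shows "inv\<^bsub>free_group S\<^esub> (free_gen S x) = free_rel S `` {[(x, False)]}"
proof (rule group.inv_equality[OF group_free_group])
  have "([(x, False), (x, True)], []) \<in> free_rel S"
    using free_rel.cancel[of "[]" S "[]" x False] assms by simp
  then show "free_rel S `` {[(x, False)]} \<otimes>\<^bsub>free_group S\<^esub> free_gen S x = \<one>\<^bsub>free_group S\<^esub>"
    using assms equiv_class_eq[OF equiv_free_rel]
    by (simp add: free_gen_def mult_free_group one_free_group)
qed (use assms in \<open>simp_all add: free_gen_def class_in_free_group\<close>)

lemma letter_class_in_free_letters:
  assumes "a \<in> S \<times> UNIV"
  shows "free_rel S `` {[a]} \<in> free_letters S"
proof -
  obtain x b where "a = (x, b)" "x \<in> S"
    using assms by auto
  then show ?thesis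
    by (cases b) (auto simp: free_letters_def free_gen_def simp flip: inv_free_gen)
qed

lemma list_prod_letter_classes:
  "w \<in> fwords S \<Longrightarrow>
    list_prod (free_group S) (map (\<lambda>a. free_rel S `` {[a]}) w) = free_rel S `` {w}"
proof (induction w)
  case Nil
  then show ?case by (simp add: list_prod_def one_free_group)
next
  case (Cons a w)
  obtain x b where "a = (x, b)" by (cases a)
  then show ?case
    using Cons mult_free_group[of "[a]" S w] by (simp add: list_prod_def)
qed

section \<open>Word values and bounds on the palindromic width\<close>

lemma palindromic_width_le:
  assumes "\<And>g. g \<in> carrier G \<Longrightarrow>
    \<exists>ps. length ps \<le> n \<and> set ps \<subseteq> palindromes G S \<and> g = list_prod G ps"
  shows "palindromic_width G S \<le> enat n"
  unfolding palindromic_width_def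
proof (rule SUP_least)
  fix g assume "g \<in> carrier G"
  then obtain ps where "length ps \<le> n" "set ps \<subseteq> palindromes G S" "g = list_prod G ps"
    using assms by blast
  then show "(INF k \<in> {k. \<exists>ps. length ps = k \<and> set ps \<subseteq> palindromes G S \<and> g = list_prod G ps}.
      enat k) \<le> enat n"
    by (intro INF_lower2[of "length ps"]) auto
qed

context group
begin

lemma word_eval_Nil [simp]: "word_eval G [] = \<one>"
  by (simp add: word_eval_def list_prod_def)

lemma word_eval_inv_word:
  assumes "S \<subseteq> carrier G" "w \<in> fwords S"
  shows "word_eval G (inv_word w) = inv (word_eval G w)"
proof (rule inv_equality[symmetric])
  show "word_eval G (inv_word w) \<otimes> word_eval G w = \<one>"
    using word_eval_free_rel[OF assms(1) inv_word_cancel[OF assms(2)]]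
    by (simp add: word_eval_append[OF assms(1)] assms(2))
qed (use assms in \<open>simp_all add: word_eval_closed\<close>)

lemma generate_eq_word_eval:
  assumes "S \<subseteq> carrier G"
  shows "generate G S = word_eval G ` fwords S"
proof (intro subset_antisym subsetI)
  fix g assume "g \<in> generate G S"
  then show "g \<in> word_eval G ` fwords S"
  proof (induction rule: generate.induct)
    case one
    show ?case by (rule image_eqI[of _ _ "[]"]) auto
  next
    case (incl h)
    then show ?case
      using assms by (intro image_eqI[of _ _ "[(h, True)]"]) (auto simp: word_eval_def list_prod_def)
  next
    case (inv h)
    then show ?case
      using assms by (intro image_eqI[of _ _ "[(h, False)]"]) (auto simp: word_eval_def list_prod_def)
  next
    case (eng h1 h2)
    then obtain u v where "u \<in> fwords S" "v \<in> fwords S" "h1 = word_eval G u" "h2 = word_eval G v"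
      by blast
    then show ?case
      by (intro image_eqI[of _ _ "u @ v"]) (simp_all add: word_eval_append[OF assms])
  qed
next
  fix g assume "g \<in> word_eval G ` fwords S"
  then obtain w where "w \<in> fwords S" "g = word_eval G w" by blast
  then show "g \<in> generate G S"
  proof (induction w arbitrary: g)
    case Nil
    then show ?case by (simp add: generate.one)
  next
    case (Cons a w)
    then obtain x b where "a = (x, b)" "x \<in> S" "w \<in> fwords S" by (cases a) auto
    then show ?case
      using Cons by (cases b) (simp_all add: word_eval_def list_prod_def generate.intros)
  qed
qed

text \<open>Sending each letter to its class preserves the symmetry of the word, so the class of
  \<open>w\<close> is a palindrome of the free group. From here on palindromes can be handled as
  plain words, without quotients.\<close>

lemma word_eval_palindrome:
  assumes "S \<subseteq> carrier G" "w \<in> fwords S" "rev w = w"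
  shows "word_eval G w \<in> palindromes G S"
proof -
  let ?ys = "map (\<lambda>a. free_rel S `` {[a]}) w"
  have "set ?ys \<subseteq> free_letters S"
    using assms(2) letter_class_in_free_letters by (fastforce simp: fwords_def)
  moreover have "rev ?ys = ?ys"
    by (simp add: rev_map assms(3))
  ultimately have "free_rel S `` {w} \<in> free_palindromes S"
    using list_prod_letter_classes[OF assms(2)] unfolding free_palindromes_def by blast
  then show ?thesis
    using natural_map_class[OF assms(1,2)] word_eval_closed[OF assms(1,2)]
      class_in_free_group[OF assms(2)]
    unfolding palindromes_def by blast
qed

text \<open>A single letter is a palindrome, so \<open>g\<close> is a product of at most
  \<open>Suc n\<close> palindromes. Both cases of the theorem end here: \<open>p\<close> is a
  reversed relator or a square, and \<open>w\<close> a remainder of uniformly bounded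
  length.\<close>

lemma palindromic_width_finite:
  assumes "S \<subseteq> carrier G"
    and "\<And>g. g \<in> carrier G \<Longrightarrow>
      \<exists>p\<in>palindromes G S. \<exists>w\<in>fwords S. length w \<le> n \<and> g = p \<otimes> word_eval G w"
  shows "palindromic_width G S < \<infinity>"
proof -
  have "\<exists>ps. length ps \<le> Suc n \<and> set ps \<subseteq> palindromes G S \<and> g = list_prod G ps"
    if g: "g \<in> carrier G" for g
  proof -
    obtain p w where pw: "p \<in> palindromes G S" "w \<in> fwords S" "length w \<le> n"
      "g = p \<otimes> word_eval G w"
      using assms(2)[OF g] by blast
    let ?ls = "map (\<lambda>(x, b). if b then x else inv x) w"
    have "(if b then x else inv x) \<in> palindromes G S" if "(x, b) \<in> set w" for x b
    proof -
      have "x \<in> S" using that pw(2) by (auto simp: fwords_def)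
      then show ?thesis
        using word_eval_palindrome[of S "[(x, b)]"] assms(1)
        by (auto simp: word_eval_def list_prod_def)
    qed
    then have "set (p # ?ls) \<subseteq> palindromes G S"
      using pw(1) by auto
    moreover have "g = list_prod G (p # ?ls)"
      using pw(4) by (simp add: word_eval_def list_prod_def)
    ultimately show ?thesis
      using pw(3) by (intro exI[of _ "p # ?ls"]) simp
  qed
  then show ?thesis
    by (rule le_less_trans[OF palindromic_width_le enat_ord_simps(4)[THEN iffD2]]) simp_all
qed

section \<open>Reversal of words and relators\<close>

lemma normal_reversed_relators:
  assumes "S \<subseteq> carrier G" "generate G S = carrier G"
  shows "{word_eval G (rev w) | w. w \<in> fwords S \<and> word_eval G w = \<one>} \<lhd> G"
    (is "?N \<lhd> G")
\<comment> \<open>Reversal induces an anti-automorphism of the free group, so it maps the kernel of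
  evaluation to a normal subgroup. Evaluation is onto and carries that subgroup to a normal subgroup
  of \<open>G\<close>. The steps below verify this with explicit words.\<close>
proof (rule normal_invI)
  note eval_simps = word_eval_append[OF assms(1)] word_eval_inv_word[OF assms(1)]
    word_eval_closed[OF assms(1)]
  show "subgroup ?N G"
  proof (rule subgroupI)
    show "?N \<subseteq> carrier G"
      by (auto simp: eval_simps)
    have "word_eval G (rev []) \<in> ?N"
      by (intro CollectI exI[of _ "[]"]) simp
    then show "?N \<noteq> {}" by blast
  next
    fix g assume "g \<in> ?N"
    then obtain w where "w \<in> fwords S" "word_eval G w = \<one>" "g = word_eval G (rev w)" by blast
    then show "inv g \<in> ?N"
      by (intro CollectI exI[of _ "inv_word w"]) (simp add: eval_simps rev_inv_word)
  next
    fix g h assume "g \<in> ?N" "h \<in> ?N"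
    then obtain u v where "u \<in> fwords S" "word_eval G u = \<one>" "g = word_eval G (rev u)"
      "v \<in> fwords S" "word_eval G v = \<one>" "h = word_eval G (rev v)" by blast
    \<comment> \<open>Reversal swaps factors, so the relators are concatenated in the opposite
      order.\<close>
    then show "g \<otimes> h \<in> ?N"
      by (intro CollectI exI[of _ "v @ u"]) (simp add: eval_simps)
  qed
next
  note eval_simps = word_eval_append[OF assms(1)] word_eval_inv_word[OF assms(1)]
    word_eval_closed[OF assms(1)]
  fix g h assume "g \<in> ?N" "h \<in> carrier G"
  then obtain w u where "w \<in> fwords S" "word_eval G w = \<one>" "g = word_eval G (rev w)"
    "u \<in> fwords S" "h = word_eval G u"
    using assms(2) generate_eq_word_eval[OF assms(1)] by blast
  \<comment> \<open>The conjugating word is \<open>rev u\<close>, because the whole word reverses to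
    \<open>u @ rev w @ inv_word u\<close>, with value \<open>h\<close> times \<open>g\<close> times
    the inverse of \<open>h\<close>.\<close>
  then show "h \<otimes> g \<otimes> inv h \<in> ?N"
    by (intro CollectI exI[of _ "inv_word (rev u) @ w @ rev u"])
      (simp add: eval_simps m_assoc rev_inv_word)
qed

lemma palindromic_width_finite_if_reversed_relator:
  assumes "just_infinite G" "S \<subseteq> carrier G" "generate G S = carrier G"
    and "w \<in> fwords S" "word_eval G w = \<one>" "word_eval G (rev w) \<noteq> \<one>"
  shows "palindromic_width G S < \<infinity>"
proof -
  define N where "N = {word_eval G (rev w) | w. w \<in> fwords S \<and> word_eval G w = \<one>}"
  have normal: "N \<lhd> G"
    unfolding N_def using assms by (intro normal_reversed_relators)
  then have N_carrier: "N \<subseteq> carrier G"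
    by (rule normal_imp_subgroup[THEN subgroup.subset])
  have palindrome: "p \<in> palindromes G S" if "p \<in> N" for p
  proof -
    obtain v where v: "v \<in> fwords S" "word_eval G v = \<one>" "p = word_eval G (rev v)"
      using \<open>p \<in> N\<close> unfolding N_def by blast
    then have "p = word_eval G (rev v @ v)"
      by (simp add: word_eval_append[OF assms(2)] word_eval_closed[OF assms(2)])
    then show ?thesis
      using v by (simp add: word_eval_palindrome[OF assms(2)])
  qed
  have "N \<noteq> {\<one>}"
    using assms unfolding N_def by blast
  then have finite_rcosets: "finite (rcosets N)"
    using normal assms(1) unfolding just_infinite_def FactGroup_def by auto
  have "\<exists>u\<in>fwords S. C = N #> word_eval G u" if "C \<in> rcosets N" for C
    using that generate_eq_word_eval[OF assms(2)] unfolding RCOSETS_def assms(3) by auto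
  \<comment> \<open>\<open>f\<close> fixes one word representing each coset. As there are finitely
    many cosets, the maximal length of these words bounds the remainder left after splitting off an
    element of \<open>N\<close>.\<close>
  then obtain f where f: "\<And>C. C \<in> rcosets N \<Longrightarrow> f C \<in> fwords S \<and> C = N #> word_eval G (f C)"
    by metis
  show ?thesis
  proof (rule palindromic_width_finite[OF assms(2)])
    fix g assume g: "g \<in> carrier G"
    define C where "C = N #> g"
    have C: "C \<in> rcosets N"
      unfolding C_def using g N_carrier by (rule rcosetsI[rotated])
    have "g \<in> N #> word_eval G (f C)"
      using f[OF C] rcos_self[OF g normal_imp_subgroup[OF normal]] by (simp add: C_def)
    then obtain p where "p \<in> N" "g = p \<otimes> word_eval G (f C)"
      unfolding r_coset_def by blast
    moreover have "length (f C) \<le> Max ((length \<circ> f) ` (rcosets N))"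
      using finite_rcosets C by (intro Max_ge) auto
    ultimately show "\<exists>p\<in>palindromes G S. \<exists>w\<in>fwords S.
        length w \<le> Max ((length \<circ> f) ` (rcosets N)) \<and> g = p \<otimes> word_eval G w"
      using f[OF C] palindrome by blast
  qed
qed

text \<open>If \<open>u\<close> and \<open>v\<close> represent \<open>x\<close> and
  \<open>y\<close>, then \<open>u @ v\<close> has value \<open>x\<close> times \<open>y\<close>,
  whereas its reversal \<open>rev v @ rev u\<close> has value \<open>y\<close> times
  \<open>x\<close>.\<close>

lemma comm_groupI_word_eval_rev:
  assumes "S \<subseteq> carrier G" "generate G S = carrier G"
    and "\<And>w. w \<in> fwords S \<Longrightarrow> word_eval G (rev w) = word_eval G w"
  shows "comm_group G"
proof (rule group_comm_groupI)
  fix x y assume "x \<in> carrier G" "y \<in> carrier G"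
  then obtain u v where "u \<in> fwords S" "x = word_eval G u" "v \<in> fwords S" "y = word_eval G v"
    using assms(2) generate_eq_word_eval[OF assms(1)] by blast
  then show "x \<otimes> y = y \<otimes> x"
    using assms(3)[of "u @ v"] assms(3)[of u] assms(3)[of v]
    by (simp add: word_eval_append[OF assms(1)])
qed

end

section \<open>Commutative groups\<close>

lemma (in comm_group) word_eval_rev:
  assumes "S \<subseteq> carrier G" "w \<in> fwords S"
  shows "word_eval G (rev w) = word_eval G w"
  using assms(2)
proof (induction w)
  case (Cons a w)
  obtain x b where "a = (x, b)" by (cases a)
  then have "[a] \<in> fwords S" "w \<in> fwords S"
    using Cons.prems by simp_all
  then show ?case
    using Cons.IH word_eval_append[OF assms(1), of "[a]" w]
    by (simp add: word_eval_append[OF assms(1)] word_eval_closed[OF assms(1)] m_comm)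
qed simp

text \<open>Letters are absorbed one at a time. A letter not yet in \<open>u\<close> is added to it;
  a letter already there is deleted from \<open>u\<close>, and the resulting pair contributes one
  copy to \<open>v\<close>. The sign belongs to the letter, so \<open>x\<close> and its formal
  inverse may both occur in \<open>u\<close>.\<close>

lemma (in comm_group) word_eval_square_times_distinct:
  assumes "S \<subseteq> carrier G" "w \<in> fwords S"
  shows "\<exists>v\<in>fwords S. \<exists>u\<in>fwords S. distinct u \<and>
    word_eval G w = word_eval G v \<otimes> word_eval G v \<otimes> word_eval G u"
  using assms(2)
proof (induction w)
  case Nil
  show ?case by (intro bexI[of _ "[]"]) auto
next
  case (Cons a w)
  note append = word_eval_append[OF assms(1)] and closed = word_eval_closed[OF assms(1)]
  obtain x b where a: "a = (x, b)" by (cases a)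
  then have a_w: "[a] \<in> fwords S" "w \<in> fwords S"
    using Cons.prems by simp_all
  then obtain v u where uv: "v \<in> fwords S" "u \<in> fwords S" "distinct u"
    "word_eval G w = word_eval G v \<otimes> word_eval G v \<otimes> word_eval G u"
    using Cons.IH by blast
  have eval: "word_eval G (a # w) = word_eval G [a] \<otimes> word_eval G w"
    using append[OF a_w] by simp
  show ?case
  proof (cases "a \<in> set u")
    case False
    then have "distinct (a # u)" "a # u \<in> fwords S"
      using uv a_w a by simp_all
    moreover have "word_eval G (a # u) = word_eval G [a] \<otimes> word_eval G u"
      using append[OF a_w(1) uv(2)] by simp
    then have "word_eval G (a # w) = word_eval G v \<otimes> word_eval G v \<otimes> word_eval G (a # u)"
      using uv eval a_w by (simp add: closed m_ac)
    ultimately show ?thesis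
      using uv(1) by blast
  next
    case True
    then obtain u1 u2 where u: "u = u1 @ [a] @ u2"
      by (metis append_Cons append_Nil split_list)
    then have u12: "u1 \<in> fwords S" "u2 \<in> fwords S"
      using uv(2) by (auto simp only: fwords_append)
    have "word_eval G (a # w)
        = word_eval G ([a] @ v) \<otimes> word_eval G ([a] @ v) \<otimes> word_eval G (u1 @ u2)"
      using uv(1) u12 a_w unfolding eval uv(4) u
      by (simp add: append closed m_ac del: append_Cons append_Nil)
    moreover have "[a] @ v \<in> fwords S" "u1 @ u2 \<in> fwords S" "distinct (u1 @ u2)"
      using uv(1,3) u12 a_w u unfolding fwords_append by auto
    ultimately show ?thesis
      by blast
  qed
qed

lemma (in comm_group) palindromic_width_finite_comm:
  assumes "S \<subseteq> carrier G" "finite S" "generate G S = carrier G"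
  shows "palindromic_width G S < \<infinity>"
proof (rule palindromic_width_finite[OF assms(1)])
  fix g assume "g \<in> carrier G"
  then obtain w where "w \<in> fwords S" "g = word_eval G w"
    using assms(3) generate_eq_word_eval[OF assms(1)] by blast
  then obtain v u where uv: "v \<in> fwords S" "u \<in> fwords S" "distinct u"
    "g = word_eval G v \<otimes> word_eval G v \<otimes> word_eval G u"
    using word_eval_square_times_distinct[OF assms(1)] by blast
  have "word_eval G (v @ rev v) \<in> palindromes G S"
    using uv by (intro word_eval_palindrome[OF assms(1)]) simp_all
  then have "word_eval G v \<otimes> word_eval G v \<in> palindromes G S"
    using uv by (simp add: word_eval_append[OF assms(1)] word_eval_rev[OF assms(1)])
  \<comment> \<open>A word without repeated signed letters has at most twice as many letters as
    \<open>S\<close> has elements.\<close>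
  moreover have "length u \<le> card (S \<times> (UNIV :: bool set))"
    using uv(2,3) assms(2)
    by (metis card_mono distinct_card finite_SigmaI finite_code fwords_def in_listsD subsetI)
  ultimately show "\<exists>p\<in>palindromes G S. \<exists>w\<in>fwords S.
      length w \<le> card (S \<times> (UNIV :: bool set)) \<and> g = p \<otimes> word_eval G w"
    using uv by blast
qed

section \<open>Choice of the additional generator\<close>

theorem corollary6:
  fixes G :: "('a, 'b) monoid_scheme" and S :: "'a set"
  assumes "group G"
    and "just_infinite G"
    and "S \<subseteq> carrier G"
    and "finite S"
    and "generate G S = carrier G"
  shows "\<exists>S'. (S' = S \<or> (\<exists>c\<in>carrier G. S' = S \<union> {c})) \<and>
           generate G S' = carrier G \<and>
           palindromic_width G S' < \<infinity>"
proof -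
  interpret group G by (rule assms(1))
  show ?thesis
  proof (cases "\<exists>c\<in>carrier G. \<exists>w\<in>fwords (S \<union> {c}).
      word_eval G w = \<one>\<^bsub>G\<^esub> \<and> word_eval G (rev w) \<noteq> \<one>\<^bsub>G\<^esub>")
    case True
    then obtain c w where c: "c \<in> carrier G" and w: "w \<in> fwords (S \<union> {c})"
      "word_eval G w = \<one>\<^bsub>G\<^esub>" "word_eval G (rev w) \<noteq> \<one>\<^bsub>G\<^esub>"
      by blast
    have S': "S \<union> {c} \<subseteq> carrier G"
      using c assms(3) by blast
    moreover have "generate G (S \<union> {c}) = carrier G"
      using mono_generate[of S "S \<union> {c}"] generate_incl[OF S'] assms(5) by blast
    ultimately show ?thesis
      using palindromic_width_finite_if_reversed_relator[OF assms(2) _ _ w] c by blast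
  next
    case False
    have "word_eval G (rev w) = word_eval G w" if w: "w \<in> fwords S" for w
    proof -
      \<comment> \<open>The failed case hypothesis covers every \<open>c\<close> in
        \<open>G\<close>, so the auxiliary generator may depend on the word \<open>w\<close> under
        consideration.\<close>
      define c where "c = word_eval G w"
      have c: "c \<in> carrier G"
        unfolding c_def using w by (rule word_eval_closed[OF assms(3)])
      then have S': "S \<union> {c} \<subseteq> carrier G"
        using assms(3) by blast
      have w': "w \<in> fwords (S \<union> {c})" and cw: "[(c, False)] \<in> fwords (S \<union> {c})"
        using w by (auto simp: fwords_def)
      have eval_c: "word_eval G [(c, False)] = inv\<^bsub>G\<^esub> c"
        using c by (simp add: word_eval_def list_prod_def)
      have "word_eval G ([(c, False)] @ w) = \<one>\<^bsub>G\<^esub>"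
        using word_eval_append[OF S' cw w'] c unfolding eval_c by (simp flip: c_def)
      moreover have "[(c, False)] @ w \<in> fwords (S \<union> {c})"
        using w' by simp
      ultimately have "word_eval G (rev ([(c, False)] @ w)) = \<one>\<^bsub>G\<^esub>"
        using False c by blast
      \<comment> \<open>Reversal moves the inverse of \<open>c\<close> from the front of the relator
        to its end.\<close>
      then have "word_eval G (rev w) \<otimes>\<^bsub>G\<^esub> inv\<^bsub>G\<^esub> c = \<one>\<^bsub>G\<^esub>"
        using word_eval_append[OF S' _ cw, of "rev w"] w' eval_c by simp
      then show ?thesis
        using c word_eval_closed[OF assms(3), of "rev w"] w inv_solve_right' c_def by fastforce
    qed
    then interpret comm_group G
      by (rule comm_groupI_word_eval_rev[OF assms(3,5)])
    \<comment> \<open>In the commutative case \<open>S\<close> itself serves as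
      \<open>S'\<close>.\<close>
    show ?thesis
      using palindromic_width_finite_comm[OF assms(3,4,5)] assms(5) by blast
  qed
qed

end
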